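(* Let $N\ge 1$ be an integer, $\tau=T/N$, and suppose $u_h^0=R_hu^0$ and $u_h^1,\dots,u_h^N\in V_h^k$ solve the fully implicit Crank-Nicolson discontinuous Galerkin scheme, i.e. for every $n=1,\dots,N$ $$(D_\tau u_{h}^{n},v_{h})+(\nu + \mathrm{i}\alpha)\,a_h(\hat{u}_h^n, v_h)+(\kappa + \mathrm{i}\beta)\,(| \hat{u}^n_h |^2 \hat{u}_h^n,v_h)-\gamma\, (\hat{u}_h^n,v_h)=0\qquad \text{for all } v_h\in V_h^k .$$ If $\tau\gamma\le 1$, then $$\|u_h^{n}\|\le e^{2T\max\{0,\gamma\}}\,\|u_h^0\|,\qquad 1\le n\le N.$$
   Context: Problem: $\Omega\subset\mathbb{R}^2$ is a bounded convex polygonal domain, $T>0$, and $\nu>0$, $\kappa>0$, $\alpha,\beta,\gamma$ are given real constants. $u^0$ is a sufficiently smooth complex-valued function on $\bar\Omega$ (in particular $u^0\in H^{k+1}(\Omega)$) with zero boundary trace. The scheme approximates the Ginzburg-Landau equation $u_t-(\nu+\mathrm{i}\alpha)\Delta u+(\kappa+\mathrm{i}\beta)|u|^2u-\gamma u=0$ in $\Omega\times(0,T]$ with $u=0$ on $\partial\Omega\times(0,T]$ and $u(\cdot,0)=u^0$. Inner product: $(u,v)=\int_\Omega u v^*\,\mathrm{d}\boldsymbol{x}$, where $v^*$ is the complex conjugate; $\|u\|=\sqrt{(u,u)}$ is the $L^2(\Omega)$ norm. Mesh and space: $\mathcal{K}_h$ belongs to a sequence of conforming quasi-uniform triangulations of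 $\Omega$ with mesh size $h$ (largest element diameter); $\mathcal{E}_h$ is the set of all edges, with interior edges $\mathcal{E}_h^i$ and boundary edges $\mathcal{E}_h^b$; $h_E$ is the length of $E$. Each edge $E$ has a fixed unit normal $\boldsymbol{n}_E$ (outward to $\Omega$ if $E\subset\partial\Omega$). For $E\in\mathcal{E}_h^i$ shared by $K_1,K_2$, where $\boldsymbol{n}_E$ points out of $K_1$, $\{v\}=\frac12(v|_{K_1}+v|_{K_2})$ and $[v]=v|_{K_1}-v|_{K_2}$; for $E\in\mathcal{E}_h^b$, $\{v\}=[v]=v|_K$. For a fixed integer $k\ge1$, $V_h^k=\{v_h\in L^2(\Omega;\mathbb{C}): v_h|_K\in\mathbb{P}_k(K)\ \forall K\in\mathcal{K}_h\}$, with $\mathbb{P}_k(K)$ the complex polynomials of total degree at most $k$. DG norm: $\|v_h\|_{\mathrm{DG}}=\big(\sum_{K}\int_K|\nabla v_h|^2\,\mathrm{d}\boldsymbol{x}+\sum_{E\in\mathcal{E}_h}\frac1{h_E}\int_E|[v_h]|^2\,\mathrm{d}s\big)^{1/2}$. Bilinear form (with $\nabla_h$ the piecewise gradient): $$a_h(v_h,w_h)=\int_\Omega\nabla_hv_h\cdot\nabla_hw_h^*\,\mathrm{d}\boldsymbol{x}-\sum_{E\in\mathcal{E}_h}\int_E\{\nabla_hv_h\}\cdot\boldsymbol{n}_E[w_h^*]\,\mathrm{d}s-\sum_{E\in\mathcal{E}_h}\int_E[v_h]\{\nabla_hw_h^*\}\cdot\boldsymbol{n}_E\,\mathrm{d}s+\sum_{E\in\mathcal{E}_h}\frac{\lambda}{h_E}\int_E[v_h][w_h^*]\,\mathrm{d}s,$$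 where the penalty parameter $\lambda$ is fixed sufficiently large (independently of $h$), so that there are constants $C_1,C_2>0$ independent of $h$ with $C_1\|v_h\|_{\mathrm{DG}}^2\le a_h(v_h,v_h)\le C_2\|v_h\|_{\mathrm{DG}}^2$ for all $v_h\in V_h^k$. Ritz projection: for $w\in H^{k+1}(\Omega)$, $R_hw\in V_h^k$ is defined by $a_h(R_hw,v_h)=-(\Delta w,v_h)$ for all $v_h\in V_h^k$. Time grid: $t_n=n\tau$, $D_\tau\phi^n=(\phi^n-\phi^{n-1})/\tau$, $\hat\phi^n=(\phi^n+\phi^{n-1})/2$. *)

theory Defs
  imports "HOL-Analysis.Analysis"
begin

section \<open>Function spaces on a planar domain\<close>

text \<open>Elements of \<open>L\<^sup>2(\<Omega>)\<close> are represented by functions on the whole plane; only their values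
  almost everywhere in \<open>\<Omega>\<close> matter.\<close>

definition L2 :: "(real^2) set \<Rightarrow> (real^2 \<Rightarrow> complex) set" where
  "L2 \<Omega> = {f. f \<in> borel_measurable (lebesgue_on \<Omega>) \<and>
              integrable (lebesgue_on \<Omega>) (\<lambda>x. (cmod (f x))\<^sup>2)}"

definition L2_inner :: "(real^2) set \<Rightarrow> (real^2 \<Rightarrow> complex) \<Rightarrow> (real^2 \<Rightarrow> complex) \<Rightarrow> complex" where
  "L2_inner \<Omega> u v = (LINT x|lebesgue_on \<Omega>. u x * cnj (v x))"

definition L2_norm :: "(real^2) set \<Rightarrow> (real^2 \<Rightarrow> complex) \<Rightarrow> real" where
  "L2_norm \<Omega> u = sqrt (Re (L2_inner \<Omega> u u))"

definition partial :: "2 \<Rightarrow> (real^2 \<Rightarrow> complex) \<Rightarrow> real^2 \<Rightarrow> complex" where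
  "partial i f x = frechet_derivative f (at x) (axis i 1)"

definition grad :: "(real^2 \<Rightarrow> complex) \<Rightarrow> real^2 \<Rightarrow> complex^2" where
  "grad f x = (\<chi> i. partial i f x)"

text \<open>A list of coordinate indices plays the role of a multi-index.\<close>

fun partials :: "2 list \<Rightarrow> (real^2 \<Rightarrow> complex) \<Rightarrow> real^2 \<Rightarrow> complex" where
  "partials [] f = f"
| "partials (i # is) f = partial i (partials is f)"

text \<open>\<open>C\<^sub>c\<^sup>\<infinity>(\<Omega>)\<close>: differentiability of every iterated partial derivative makes all of them continuous.\<close>

definition test_function :: "(real^2) set \<Rightarrow> (real^2 \<Rightarrow> complex) \<Rightarrow> bool" where
  "test_function \<Omega> \<phi> \<longleftrightarrow>
     (\<forall>is x. partials is \<phi> differentiable (at x)) \<and>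
     compact (closure {x. \<phi> x \<noteq> 0}) \<and> closure {x. \<phi> x \<noteq> 0} \<subseteq> \<Omega>"

definition has_weak_partials ::
    "(real^2) set \<Rightarrow> 2 list \<Rightarrow> (real^2 \<Rightarrow> complex) \<Rightarrow> (real^2 \<Rightarrow> complex) \<Rightarrow> bool" where
  "has_weak_partials \<Omega> is f g \<longleftrightarrow> f \<in> L2 \<Omega> \<and> g \<in> L2 \<Omega> \<and>
     (\<forall>\<phi>. test_function \<Omega> \<phi> \<longrightarrow>
        (LINT x|lebesgue_on \<Omega>. f x * partials is \<phi> x) =
        (-1) ^ length is * (LINT x|lebesgue_on \<Omega>. g x * \<phi> x))"

definition Sobolev_H :: "nat \<Rightarrow> (real^2) set \<Rightarrow> (real^2 \<Rightarrow> complex) set" where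
  "Sobolev_H m \<Omega> = {f \<in> L2 \<Omega>. \<forall>is. length is \<le> m \<longrightarrow> (\<exists>g. has_weak_partials \<Omega> is f g)}"

text \<open>Weak derivatives are unique almost everywhere, so the choice of representative is immaterial.\<close>

definition weak_laplacian :: "(real^2) set \<Rightarrow> (real^2 \<Rightarrow> complex) \<Rightarrow> real^2 \<Rightarrow> complex" where
  "weak_laplacian \<Omega> w x = (\<Sum>i\<in>UNIV. (SOME g. has_weak_partials \<Omega> [i, i] w g) x)"

section \<open>Triangulations\<close>

definition convex_polygonal_domain :: "(real^2) set \<Rightarrow> bool" where
  "convex_polygonal_domain \<Omega> \<longleftrightarrow>
     open \<Omega> \<and> \<Omega> \<noteq> {} \<and> bounded \<Omega> \<and> convex \<Omega> \<and> polytope (closure \<Omega>)"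

text \<open>Elements are closed triangles; \<^const>\<open>triangulation\<close> contains the conformity requirement that
  two elements meet in a common face.\<close>

definition conforming_mesh :: "(real^2) set \<Rightarrow> (real^2) set set \<Rightarrow> bool" where
  "conforming_mesh \<Omega> \<K> \<longleftrightarrow> triangulation \<K> \<and> (\<forall>K\<in>\<K>. 2 simplex K) \<and> \<Union>\<K> = closure \<Omega>"

definition mesh_size :: "(real^2) set set \<Rightarrow> real" where
  "mesh_size \<K> = Max (diameter ` \<K>)"

text \<open>Every element contains a disc whose diameter is at least a fixed fraction of the mesh size.\<close>

definition quasi_uniform :: "(nat \<Rightarrow> (real^2) set set) \<Rightarrow> bool" where
  "quasi_uniform \<K> \<longleftrightarrow>
     (\<exists>\<rho>>0. \<forall>m. \<forall>K\<in>\<K> m. \<exists>x r. cball x r \<subseteq> K \<and> 2 * r \<ge> \<rho> * mesh_size (\<K> m))"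

definition edges :: "(real^2) set set \<Rightarrow> (real^2) set set" where
  "edges \<K> = {E. \<exists>K\<in>\<K>. E facet_of K}"

definition boundary_edges :: "(real^2) set \<Rightarrow> (real^2) set set \<Rightarrow> (real^2) set set" where
  "boundary_edges \<Omega> \<K> = {E \<in> edges \<K>. E \<subseteq> frontier \<Omega>}"

text \<open>The length of an edge \<open>E\<close> is \<open>diameter E\<close>.\<close>

definition edge_normals :: "(real^2) set \<Rightarrow> (real^2) set set \<Rightarrow> ((real^2) set \<Rightarrow> real^2) \<Rightarrow> bool" where
  "edge_normals \<Omega> \<K> \<eta> \<longleftrightarrow>
     (\<forall>E\<in>edges \<K>. norm (\<eta> E) = 1 \<and> (\<forall>x\<in>E. \<forall>y\<in>E. \<eta> E \<bullet> (y - x) = 0)) \<and>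
     (\<forall>E\<in>boundary_edges \<Omega> \<K>. \<forall>x\<in>E. \<forall>y\<in>\<Omega>. \<eta> E \<bullet> (y - x) \<le> 0)"

text \<open>The element \<open>K\<^sub>1\<close> out of which the normal points, and the element \<open>K\<^sub>2\<close> into which it points
  (the latter exists for interior edges only).\<close>

definition elem1 :: "(real^2) set set \<Rightarrow> ((real^2) set \<Rightarrow> real^2) \<Rightarrow> (real^2) set \<Rightarrow> (real^2) set" where
  "elem1 \<K> \<eta> E = (THE K. K \<in> \<K> \<and> E facet_of K \<and> (\<forall>x\<in>E. \<forall>y\<in>K. \<eta> E \<bullet> (y - x) \<le> 0))"

definition elem2 :: "(real^2) set set \<Rightarrow> ((real^2) set \<Rightarrow> real^2) \<Rightarrow> (real^2) set \<Rightarrow> (real^2) set" where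
  "elem2 \<K> \<eta> E = (THE K. K \<in> \<K> \<and> E facet_of K \<and> (\<forall>x\<in>E. \<forall>y\<in>K. \<eta> E \<bullet> (y - x) \<ge> 0))"

text \<open>Integration with respect to arc length, by the affine parametrisation of the edge; the result
  does not depend on which endpoint comes first.\<close>

definition edge_integral ::
    "(real^2) set \<Rightarrow> (real^2 \<Rightarrow> 'b::{banach, second_countable_topology}) \<Rightarrow> 'b" where
  "edge_integral E f =
     (let (a, b) = (SOME (a, b). E = closed_segment a b)
      in dist a b *\<^sub>R (LINT t|lebesgue_on {0..1}. f (linepath a b t)))"

section \<open>Discontinuous finite elements\<close>

definition polys :: "nat \<Rightarrow> (real^2 \<Rightarrow> complex) set" where
  "polys k = {p. \<exists>c. p = (\<lambda>x. \<Sum>(i, j)\<in>{(i, j). i + j \<le> k}.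
                 c i j * of_real (x $ 1) ^ i * of_real (x $ 2) ^ j)}"

definition DG_space :: "(real^2) set \<Rightarrow> (real^2) set set \<Rightarrow> nat \<Rightarrow> (real^2 \<Rightarrow> complex) set" where
  "DG_space \<Omega> \<K> k =
     {v \<in> L2 \<Omega>. \<forall>K\<in>\<K>. \<exists>p\<in>polys k. AE x in lebesgue_on K. v x = p x}"

text \<open>The restriction of \<open>v\<close> to \<open>K\<close>, as the polynomial that represents it almost everywhere. A
  polynomial is determined by its values almost everywhere on a triangle. Traces on the edges of \<open>K\<close>
  are values of this polynomial.\<close>

definition restr :: "(real^2 \<Rightarrow> complex) \<Rightarrow> (real^2) set \<Rightarrow> real^2 \<Rightarrow> complex" where
  "restr v K = (SOME p. p \<in> (\<Union>k. polys k) \<and> (AE x in lebesgue_on K. v x = p x))"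

definition pw_grad :: "(real^2) set set \<Rightarrow> (real^2 \<Rightarrow> complex) \<Rightarrow> real^2 \<Rightarrow> complex^2" where
  "pw_grad \<K> v x = (\<Sum>K\<in>\<K>. indicator (interior K) x *\<^sub>R grad (restr v K) x)"

definition jump ::
    "(real^2) set \<Rightarrow> (real^2) set set \<Rightarrow> ((real^2) set \<Rightarrow> real^2) \<Rightarrow> (real^2) set \<Rightarrow>
     (real^2 \<Rightarrow> complex) \<Rightarrow> real^2 \<Rightarrow> complex" where
  "jump \<Omega> \<K> \<eta> E v x =
     (if E \<in> boundary_edges \<Omega> \<K> then restr v (elem1 \<K> \<eta> E) x
      else restr v (elem1 \<K> \<eta> E) x - restr v (elem2 \<K> \<eta> E) x)"

definition avg_grad ::
    "(real^2) set \<Rightarrow> (real^2) set set \<Rightarrow> ((real^2) set \<Rightarrow> real^2) \<Rightarrow> (real^2) set \<Rightarrow>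
     (real^2 \<Rightarrow> complex) \<Rightarrow> real^2 \<Rightarrow> complex^2" where
  "avg_grad \<Omega> \<K> \<eta> E v x =
     (if E \<in> boundary_edges \<Omega> \<K> then grad (restr v (elem1 \<K> \<eta> E)) x
      else (1 / 2) *\<^sub>R (grad (restr v (elem1 \<K> \<eta> E)) x + grad (restr v (elem2 \<K> \<eta> E)) x))"

text \<open>\<open>\<psi> \<cdot> n\<close> for a complex vector and a real normal.\<close>

definition normal_comp :: "complex^2 \<Rightarrow> real^2 \<Rightarrow> complex" where
  "normal_comp \<psi> n = (\<Sum>i\<in>UNIV. \<psi> $ i * of_real (n $ i))"

definition DG_norm ::
    "(real^2) set \<Rightarrow> (real^2) set set \<Rightarrow> ((real^2) set \<Rightarrow> real^2) \<Rightarrow> (real^2 \<Rightarrow> complex) \<Rightarrow> real" where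
  "DG_norm \<Omega> \<K> \<eta> v =
     sqrt ((\<Sum>K\<in>\<K>. LINT x|lebesgue_on K. (norm (grad (restr v K) x))\<^sup>2) +
           (\<Sum>E\<in>edges \<K>. 1 / diameter E * edge_integral E (\<lambda>x. (cmod (jump \<Omega> \<K> \<eta> E v x))\<^sup>2)))"

text \<open>The sesquilinear symmetric interior penalty form with penalty parameter \<open>lam\<close>. Since normals are
  real, \<open>{\<nabla>w\<^sup>*} \<cdot> n\<close> is the conjugate of \<open>{\<nabla>w} \<cdot> n\<close>.\<close>

definition DG_form ::
    "(real^2) set \<Rightarrow> (real^2) set set \<Rightarrow> ((real^2) set \<Rightarrow> real^2) \<Rightarrow> real \<Rightarrow>
     (real^2 \<Rightarrow> complex) \<Rightarrow> (real^2 \<Rightarrow> complex) \<Rightarrow> complex" where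
  "DG_form \<Omega> \<K> \<eta> lam v w =
     (LINT x|lebesgue_on \<Omega>. (\<Sum>i\<in>UNIV. pw_grad \<K> v x $ i * cnj (pw_grad \<K> w x $ i)))
     - (\<Sum>E\<in>edges \<K>. edge_integral E
          (\<lambda>x. normal_comp (avg_grad \<Omega> \<K> \<eta> E v x) (\<eta> E) * cnj (jump \<Omega> \<K> \<eta> E w x)))
     - (\<Sum>E\<in>edges \<K>. edge_integral E
          (\<lambda>x. jump \<Omega> \<K> \<eta> E v x * cnj (normal_comp (avg_grad \<Omega> \<K> \<eta> E w x) (\<eta> E))))
     + (\<Sum>E\<in>edges \<K>. of_real (lam / diameter E) * edge_integral E
          (\<lambda>x. jump \<Omega> \<K> \<eta> E v x * cnj (jump \<Omega> \<K> \<eta> E w x)))"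

text \<open>\<open>r\<close> represents the Ritz projection \<open>R\<^sub>h w\<close> of \<open>w \<in> H\<^sup>2(\<Omega>)\<close>. It is a relation because \<open>R\<^sub>h w\<close> is
  an \<open>L\<^sup>2\<close> function, that is, determined up to null sets.\<close>

definition is_Ritz_projection ::
    "(real^2) set \<Rightarrow> (real^2) set set \<Rightarrow> ((real^2) set \<Rightarrow> real^2) \<Rightarrow> real \<Rightarrow> nat \<Rightarrow>
     (real^2 \<Rightarrow> complex) \<Rightarrow> (real^2 \<Rightarrow> complex) \<Rightarrow> bool" where
  "is_Ritz_projection \<Omega> \<K> \<eta> lam k w r \<longleftrightarrow>
     r \<in> DG_space \<Omega> \<K> k \<and>
     (\<forall>v\<in>DG_space \<Omega> \<K> k. DG_form \<Omega> \<K> \<eta> lam r v = - L2_inner \<Omega> (weak_laplacian \<Omega> w) v)"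

section \<open>The fully implicit Crank--Nicolson scheme\<close>

definition time_diff :: "real \<Rightarrow> (nat \<Rightarrow> real^2 \<Rightarrow> complex) \<Rightarrow> nat \<Rightarrow> real^2 \<Rightarrow> complex" where
  "time_diff \<tau> u n x = (u n x - u (n - 1) x) / of_real \<tau>"

definition time_avg :: "(nat \<Rightarrow> real^2 \<Rightarrow> complex) \<Rightarrow> nat \<Rightarrow> real^2 \<Rightarrow> complex" where
  "time_avg u n x = (u n x + u (n - 1) x) / 2"

end

theory Submission
  imports Defs
begin

text \<open>Testing the scheme with \<open>\<hat>u\<^sup>n\<close> and taking real parts removes the diffusion and the cubic term:
  \<open>a\<^sub>h(v, v)\<close> is real by Hermitian symmetry and nonnegative by coercivity. What remains is
  \<open>\<parallel>u\<^sup>n\<parallel>\<^sup>2 - \<parallel>u\<^sup>n\<^sup>-\<^sup>1\<parallel>\<^sup>2 \<le> 2 s \<parallel>\<hat>u\<^sup>n\<parallel>\<^sup>2\<close> with \<open>s = \<tau> max {0, \<gamma>} \<le> 1\<close>.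
  The weighted parallelogram bound \<open>\<bar>(x + y)/2\<bar>\<^sup>2 \<le> \<bar>x\<bar>\<^sup>2/3 + \<bar>y\<bar>\<^sup>2\<close> turns this into
  \<open>(1 - 2s/3) \<parallel>u\<^sup>n\<parallel>\<^sup>2 \<le> (1 + 2s) \<parallel>u\<^sup>n\<^sup>-\<^sup>1\<parallel>\<^sup>2\<close>, and \<open>(1 + 2s)(1 - 2s/3) \<ge> 1\<close> on \<open>[0, 1]\<close>, so that
  \<open>\<parallel>u\<^sup>n\<parallel> \<le> (1 + 2s) \<parallel>u\<^sup>n\<^sup>-\<^sup>1\<parallel> \<le> exp (2s) \<parallel>u\<^sup>n\<^sup>-\<^sup>1\<parallel>\<close>. The equal-weight bound \<open>(\<bar>x\<bar>\<^sup>2 + \<bar>y\<bar>\<^sup>2)/2\<close> would give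
  nothing at \<open>s = 1\<close>.\<close>

section \<open>Midpoint bounds, energy difference and cubic term in
  \<open>L2 \<Omega>\<close>\<close>

lemma cmod_mult_le_squares: "cmod x * cmod y \<le> (cmod x)\<^sup>2 + (cmod y)\<^sup>2"
proof -
  have "2 * (cmod x * cmod y) \<le> (cmod x)\<^sup>2 + (cmod y)\<^sup>2"
    using sum_squares_bound[of "cmod x" "cmod y"] by (simp add: mult.assoc)
  moreover have "0 \<le> cmod x * cmod y"
    by simp
  ultimately show ?thesis
    by linarith
qed

text \<open>After the triangle inequality the gap is \<open>(cmod x - 3 * cmod y)^2 / 12\<close>. In
  the application \<open>x\<close> is the new time level, whose small weight keeps
  \<open>1 - 2 * s / 3\<close> positive at \<open>s = 1\<close>.\<close>

lemma cmod_midpoint_le: "(cmod ((x + y) / 2))\<^sup>2 \<le> (cmod x)\<^sup>2 / 3 + (cmod y)\<^sup>2"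
proof -
  have "(cmod ((x + y) / 2))\<^sup>2 = (cmod (x + y))\<^sup>2 / 4"
    by (simp add: norm_divide power_divide)
  also have "\<dots> \<le> (cmod x + cmod y)\<^sup>2 / 4"
    by (intro divide_right_mono power_mono norm_triangle_ineq) auto
  also have "\<dots> \<le> (cmod x)\<^sup>2 / 3 + (cmod y)\<^sup>2"
    using zero_le_power2[of "cmod x - 3 * cmod y"] by (simp add: power2_eq_square field_simps)
  finally show ?thesis .
qed

lemma integrable_mult_cnj:
  assumes "u \<in> L2 \<Omega>" "v \<in> L2 \<Omega>"
  shows "integrable (lebesgue_on \<Omega>) (\<lambda>x. u x * cnj (v x))"
proof (rule Bochner_Integration.integrable_bound)
  show "integrable (lebesgue_on \<Omega>) (\<lambda>x. (cmod (u x))\<^sup>2 + (cmod (v x))\<^sup>2)"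
    using assms by (auto simp: L2_def)
  have [measurable]: "u \<in> borel_measurable (lebesgue_on \<Omega>)" "v \<in> borel_measurable (lebesgue_on \<Omega>)"
    using assms by (auto simp: L2_def)
  have [measurable]: "cnj \<in> borel_measurable borel"
    by (intro borel_measurable_continuous_onI continuous_intros)
  show "(\<lambda>x. u x * cnj (v x)) \<in> borel_measurable (lebesgue_on \<Omega>)"
    by measurable
  show "AE x in lebesgue_on \<Omega>. norm (u x * cnj (v x)) \<le> norm ((cmod (u x))\<^sup>2 + (cmod (v x))\<^sup>2)"
    using cmod_mult_le_squares by (simp add: norm_mult)
qed

text \<open>The complex integral of a real integrand is real unconditionally: without integrability
  both sides are 0.\<close>

lemma L2_inner_self_integral:
  "L2_inner \<Omega> u u = of_real (LINT x|lebesgue_on \<Omega>. (cmod (u x))\<^sup>2)"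
  unfolding L2_inner_def complex_norm_square[symmetric] of_real_power[symmetric]
  by (rule integral_complex_of_real)

lemma L2_norm_square: "(L2_norm \<Omega> u)\<^sup>2 = (LINT x|lebesgue_on \<Omega>. (cmod (u x))\<^sup>2)"
  by (simp add: L2_norm_def L2_inner_self_integral)

lemma L2_inner_self: "L2_inner \<Omega> u u = of_real ((L2_norm \<Omega> u)\<^sup>2)"
  by (simp only: L2_inner_self_integral L2_norm_square)

lemma L2_norm_nonneg: "0 \<le> L2_norm \<Omega> u"
  by (simp add: L2_norm_def L2_inner_self_integral)

lemma L2_midpoint:
  assumes "u \<in> L2 \<Omega>" "v \<in> L2 \<Omega>"
  shows "(\<lambda>x. (u x + v x) / 2) \<in> L2 \<Omega>"
proof -
  have [measurable]: "u \<in> borel_measurable (lebesgue_on \<Omega>)" "v \<in> borel_measurable (lebesgue_on \<Omega>)"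
    using assms by (auto simp: L2_def)
  have "integrable (lebesgue_on \<Omega>) (\<lambda>x. (cmod ((u x + v x) / 2))\<^sup>2)"
  proof (rule Bochner_Integration.integrable_bound)
    show "integrable (lebesgue_on \<Omega>) (\<lambda>x. (cmod (u x))\<^sup>2 / 3 + (cmod (v x))\<^sup>2)"
      using assms by (auto simp: L2_def)
    show "AE x in lebesgue_on \<Omega>. norm ((cmod ((u x + v x) / 2))\<^sup>2) \<le> norm ((cmod (u x))\<^sup>2 / 3 + (cmod (v x))\<^sup>2)"
      using cmod_midpoint_le by (intro AE_I2) (simp only: real_norm_def abs_of_nonneg, simp)
  qed measurable
  then show ?thesis
    by (simp add: L2_def)
qed

lemma L2_norm_midpoint_le:
  assumes "u \<in> L2 \<Omega>" "v \<in> L2 \<Omega>"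
  shows "(L2_norm \<Omega> (\<lambda>x. (u x + v x) / 2))\<^sup>2 \<le> (L2_norm \<Omega> u)\<^sup>2 / 3 + (L2_norm \<Omega> v)\<^sup>2"
proof -
  have int: "integrable (lebesgue_on \<Omega>) (\<lambda>x. (cmod (u x))\<^sup>2 / 3)"
      "integrable (lebesgue_on \<Omega>) (\<lambda>x. (cmod (v x))\<^sup>2)"
    using assms by (auto simp: L2_def)
  have "(L2_norm \<Omega> (\<lambda>x. (u x + v x) / 2))\<^sup>2
      \<le> (LINT x|lebesgue_on \<Omega>. (cmod (u x))\<^sup>2 / 3 + (cmod (v x))\<^sup>2)"
    unfolding L2_norm_square
  proof (rule integral_mono)
    show "integrable (lebesgue_on \<Omega>) (\<lambda>x. (cmod ((u x + v x) / 2))\<^sup>2)"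
      using L2_midpoint[OF assms] unfolding L2_def by blast
  qed (use int cmod_midpoint_le in auto)
  also have "\<dots> = (L2_norm \<Omega> u)\<^sup>2 / 3 + (L2_norm \<Omega> v)\<^sup>2"
    unfolding L2_norm_square using int by simp
  finally show ?thesis .
qed

lemma Re_L2_inner_time_diff:
  assumes "u n \<in> L2 \<Omega>" "u (n - 1) \<in> L2 \<Omega>"
  shows "Re (L2_inner \<Omega> (time_diff \<tau> u n) (time_avg u n))
    = ((L2_norm \<Omega> (u n))\<^sup>2 - (L2_norm \<Omega> (u (n - 1)))\<^sup>2) / (2 * \<tau>)"
proof -
  let ?M = "lebesgue_on \<Omega>" and ?x = "u n" and ?y = "u (n - 1)"
  have int: "integrable ?M (\<lambda>x. ?x x * cnj (?x x))" "integrable ?M (\<lambda>x. ?y x * cnj (?y x))"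
      "integrable ?M (\<lambda>x. ?x x * cnj (?y x))" "integrable ?M (\<lambda>x. ?y x * cnj (?x x))"
    using assms by (auto intro: integrable_mult_cnj)
  have "(a - b) / t * cnj ((a + b) / 2) =
      (a * cnj a - b * cnj b + a * cnj b - b * cnj a) / (2 * t)" for a b t :: complex
  proof -
    have "(a - b) * cnj (a + b) = a * cnj a - b * cnj b + a * cnj b - b * cnj a"
      by (simp add: algebra_simps)
    then show ?thesis
      by (simp add: mult.commute[of t])
  qed
  then have "L2_inner \<Omega> (time_diff \<tau> u n) (time_avg u n) =
      (LINT x|?M. (?x x * cnj (?x x) - ?y x * cnj (?y x) + ?x x * cnj (?y x) - ?y x * cnj (?x x))
        / (2 * of_real \<tau>))"
    unfolding L2_inner_def time_diff_def time_avg_def by simp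
  also have "\<dots> = (L2_inner \<Omega> ?x ?x - L2_inner \<Omega> ?y ?y + L2_inner \<Omega> ?x ?y - L2_inner \<Omega> ?y ?x)
      / of_real (2 * \<tau>)"
    unfolding L2_inner_def using int by simp
  finally have "L2_inner \<Omega> (time_diff \<tau> u n) (time_avg u n) =
      (L2_inner \<Omega> ?x ?x - L2_inner \<Omega> ?y ?y + L2_inner \<Omega> ?x ?y - L2_inner \<Omega> ?y ?x) / of_real (2 * \<tau>)" .
  \<comment> \<open>The mixed terms are conjugate to each other, so their difference is imaginary
    and drops out of the real part.\<close>
  moreover have "L2_inner \<Omega> ?y ?x = cnj (L2_inner \<Omega> ?x ?y)"
    unfolding L2_inner_def Bochner_Integration.integral_cnj[symmetric]
    by (simp only: complex_cnj_mult complex_cnj_cnj mult.commute)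
  ultimately show ?thesis
    by (simp only: L2_inner_self Re_divide_of_real) simp
qed

text \<open>The integrand is \<open>cmod (v x) ^ 4\<close>. If it is not integrable, the integral is
  0 by convention, which is still nonnegative.\<close>

lemma L2_inner_cubic:
  "\<exists>r\<ge>0. L2_inner \<Omega> (\<lambda>x. (of_real (cmod (v x)))\<^sup>2 * v x) v = of_real r"
proof -
  have "(of_real (cmod z))\<^sup>2 * z * cnj z = of_real ((cmod z) ^ 4)" for z
  proof -
    have "z * cnj z = (of_real (cmod z))\<^sup>2"
      using complex_norm_square[of z] by simp
    then have "(of_real (cmod z))\<^sup>2 * z * cnj z = (of_real (cmod z))\<^sup>2 * (of_real (cmod z))\<^sup>2"
      by (simp only: mult.assoc)
    also have "\<dots> = of_real (cmod z) ^ (2 + 2)"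
      by (rule power_add[symmetric])
    finally show ?thesis
      by simp
  qed
  then have "L2_inner \<Omega> (\<lambda>x. (of_real (cmod (v x)))\<^sup>2 * v x) v
      = of_real (LINT x|lebesgue_on \<Omega>. (cmod (v x)) ^ 4)"
    unfolding L2_inner_def by (simp only: integral_complex_of_real)
  moreover have "0 \<le> (LINT x|lebesgue_on \<Omega>. (cmod (v x)) ^ 4)"
    by (rule Bochner_Integration.integral_nonneg) simp
  ultimately show ?thesis
    by (intro exI conjI)
qed

section \<open>Midpoints in the discontinuous space and symmetry of the form\<close>

lemma polys_midpoint:
  assumes "p \<in> polys k" "q \<in> polys k"
  shows "(\<lambda>x. (p x + q x) / 2) \<in> polys k"
proof -
  let ?I = "{(i, j). i + j \<le> k}"
  obtain c d where p: "p = (\<lambda>x. \<Sum>(i, j)\<in>?I. c i j * of_real (x $ 1) ^ i * of_real (x $ 2) ^ j)"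
    and q: "q = (\<lambda>x. \<Sum>(i, j)\<in>?I. d i j * of_real (x $ 1) ^ i * of_real (x $ 2) ^ j)"
    using assms unfolding polys_def by blast
  have "(p x + q x) / 2
      = (\<Sum>(i, j)\<in>?I. (c i j + d i j) / 2 * of_real (x $ 1) ^ i * of_real (x $ 2) ^ j)" for x
    unfolding p q sum.distrib[symmetric] sum_divide_distrib
    by (intro sum.cong refl) (simp add: case_prod_beta distrib_right add_divide_distrib)
  then show ?thesis
    unfolding polys_def by (intro CollectI exI[of _ "\<lambda>i j. (c i j + d i j) / 2"] ext)
qed

lemma DG_space_L2: "v \<in> DG_space \<Omega> \<K> k \<Longrightarrow> v \<in> L2 \<Omega>"
  by (simp add: DG_space_def)

text \<open>Makes \<open>time_avg u n\<close> an admissible test function in the scheme.\<close>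

lemma DG_space_midpoint:
  assumes "u \<in> DG_space \<Omega> \<K> k" "v \<in> DG_space \<Omega> \<K> k"
  shows "(\<lambda>x. (u x + v x) / 2) \<in> DG_space \<Omega> \<K> k"
proof -
  have "\<exists>r\<in>polys k. AE x in lebesgue_on K. (u x + v x) / 2 = r x" if "K \<in> \<K>" for K
  proof -
    obtain p where p: "p \<in> polys k" "AE x in lebesgue_on K. u x = p x"
      using assms(1) \<open>K \<in> \<K>\<close> by (auto simp: DG_space_def)
    obtain q where q: "q \<in> polys k" "AE x in lebesgue_on K. v x = q x"
      using assms(2) \<open>K \<in> \<K>\<close> by (auto simp: DG_space_def)
    have "AE x in lebesgue_on K. (u x + v x) / 2 = (p x + q x) / 2"
      using p(2) q(2) by eventually_elim simp
    then show ?thesis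
      using p(1) q(1) by (intro bexI[of _ "\<lambda>x. (p x + q x) / 2"] polys_midpoint)
  qed
  then show ?thesis
    using assms L2_midpoint by (auto simp: DG_space_def)
qed

text \<open>The endpoints chosen by \<open>SOME\<close> depend on \<open>E\<close> alone, so both
  sides use the same parametrisation.\<close>

lemma edge_integral_cnj: "edge_integral E (\<lambda>x. cnj (f x)) = cnj (edge_integral E f)"
  by (simp add: edge_integral_def split: prod.splits)

text \<open>Conjugation interchanges the two sums containing \<open>avg_grad\<close>; the volume and
  penalty terms are Hermitian by themselves, the weights \<open>lam / diameter E\<close> being
  real.\<close>

lemma cnj_DG_form: "cnj (DG_form \<Omega> \<K> \<eta> lam v w) = DG_form \<Omega> \<K> \<eta> lam w v"
  unfolding DG_form_def
  by (simp add: edge_integral_cnj[symmetric] Bochner_Integration.integral_cnj[symmetric] mult.commute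
      del: Bochner_Integration.integral_cnj)

text \<open>An imaginary part would enter the real part of the scheme with the factor
  \<open>-\<alpha>\<close>, whose sign is arbitrary.\<close>

lemma DG_form_self_real: "Im (DG_form \<Omega> \<K> \<eta> lam v v) = 0"
  using cnj_DG_form[of \<Omega> \<K> \<eta> lam v v] by (metis Reals_cnj_iff complex_is_Real_iff)

section \<open>From the growth over one step to the bound at all times\<close>

lemma growth_factor:
  fixes a b s :: real
  assumes "0 \<le> s" "s \<le> 1" "0 \<le> b"
    and le: "a\<^sup>2 - b\<^sup>2 \<le> 2 * s * (a\<^sup>2 / 3 + b\<^sup>2)"
  shows "a \<le> exp (2 * s) * b"
proof -
  \<comment> \<open>The product equals \<open>1 + 4/3 * s * (1 - s)\<close>, with equality to 1 at
    both ends of the interval.\<close>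
  have "1 \<le> (1 + 2 * s) * (1 - 2 * s / 3)"
    using mult_left_mono[of s 1 s] assms(1,2) by (simp add: field_simps)
  then have "a\<^sup>2 \<le> (1 + 2 * s) * (1 - 2 * s / 3) * a\<^sup>2"
    using mult_right_mono[of 1 _ "a\<^sup>2"] by fastforce
  also have "\<dots> = (1 + 2 * s) * ((1 - 2 * s / 3) * a\<^sup>2)"
    by (simp add: mult.assoc)
  also have "\<dots> \<le> (1 + 2 * s) * ((1 + 2 * s) * b\<^sup>2)"
    using le assms(1) by (intro mult_left_mono) (auto simp: algebra_simps)
  also have "\<dots> = ((1 + 2 * s) * b)\<^sup>2"
    by (simp add: power2_eq_square)
  finally have "a \<le> (1 + 2 * s) * b"
    by (rule power2_le_imp_le) (use assms in auto)
  also have "\<dots> \<le> exp (2 * s) * b"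
    using assms(3) by (intro mult_right_mono exp_ge_add_one_self) auto
  finally show ?thesis .
qed

theorem theorem3p2:
  fixes \<Omega> :: "(real^2) set"
    and T \<nu> \<kappa> \<alpha> \<beta> \<gamma> lam C1 C2 \<tau> :: real
    and \<K> :: "nat \<Rightarrow> (real^2) set set"
    and normal :: "nat \<Rightarrow> (real^2) set \<Rightarrow> real^2"
    and k m N :: nat
    and u0 :: "real^2 \<Rightarrow> complex"
    and u :: "nat \<Rightarrow> real^2 \<Rightarrow> complex"
  assumes domain: "convex_polygonal_domain \<Omega>"
    and T: "T > 0" and \<nu>: "\<nu> > 0" and \<kappa>: "\<kappa> > 0" and k: "k \<ge> 1"
    and mesh: "\<And>j. conforming_mesh \<Omega> (\<K> j)" "quasi_uniform \<K>"
    and normals: "\<And>j. edge_normals \<Omega> (\<K> j) (normal j)"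
    and C: "C1 > 0" "C2 > 0"
    and coercive: "\<And>j v. v \<in> DG_space \<Omega> (\<K> j) k \<Longrightarrow>
           C1 * (DG_norm \<Omega> (\<K> j) (normal j) v)\<^sup>2 \<le> Re (DG_form \<Omega> (\<K> j) (normal j) lam v v)"
    and bounded: "\<And>j v. v \<in> DG_space \<Omega> (\<K> j) k \<Longrightarrow>
           Re (DG_form \<Omega> (\<K> j) (normal j) lam v v) \<le> C2 * (DG_norm \<Omega> (\<K> j) (normal j) v)\<^sup>2"
    and u0: "u0 \<in> Sobolev_H (k + 1) \<Omega>" "continuous_on (closure \<Omega>) u0"
            "\<And>x. x \<in> frontier \<Omega> \<Longrightarrow> u0 x = 0"
    and N: "N \<ge> 1" and \<tau>: "\<tau> = T / real N"
    and init: "is_Ritz_projection \<Omega> (\<K> m) (normal m) lam k u0 (u 0)"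
    and sol: "\<And>n. n \<in> {1..N} \<Longrightarrow> u n \<in> DG_space \<Omega> (\<K> m) k"
    and scheme: "\<And>n v. n \<in> {1..N} \<Longrightarrow> v \<in> DG_space \<Omega> (\<K> m) k \<Longrightarrow>
           L2_inner \<Omega> (time_diff \<tau> u n) v
           + (of_real \<nu> + \<i> * of_real \<alpha>) * DG_form \<Omega> (\<K> m) (normal m) lam (time_avg u n) v
           + (of_real \<kappa> + \<i> * of_real \<beta>) *
               L2_inner \<Omega> (\<lambda>x. (of_real (cmod (time_avg u n x)))\<^sup>2 * time_avg u n x) v
           - of_real \<gamma> * L2_inner \<Omega> (time_avg u n) v = 0"
    and step: "\<tau> * \<gamma> \<le> 1"
  shows "\<forall>n\<in>{1..N}. L2_norm \<Omega> (u n) \<le> exp (2 * T * max 0 \<gamma>) * L2_norm \<Omega> (u 0)"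
proof
  fix n assume n: "n \<in> {1..N}"
  define s where "s = \<tau> * max 0 \<gamma>"
  have "\<tau> > 0"
    using T N \<tau> by simp
  have s: "0 \<le> s" "s \<le> 1"
    using \<open>\<tau> > 0\<close> step by (auto simp: s_def max_def)
  \<comment> \<open>The case \<open>j = 0\<close> lies outside \<open>sol\<close>; there membership
    is part of being a Ritz projection.\<close>
  have space: "u j \<in> DG_space \<Omega> (\<K> m) k" if "j \<le> N" for j
    using that sol[of j] init by (cases j) (auto simp: is_Ritz_projection_def)
  have one_step: "L2_norm \<Omega> (u j) \<le> exp (2 * s) * L2_norm \<Omega> (u (j - 1))" if j: "j \<in> {1..N}" for j
  proof -
    let ?v = "time_avg u j"
    let ?A = "DG_form \<Omega> (\<K> m) (normal m) lam ?v ?v"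
    let ?D = "(L2_norm \<Omega> (u j))\<^sup>2 - (L2_norm \<Omega> (u (j - 1)))\<^sup>2"
    have in_space: "u j \<in> DG_space \<Omega> (\<K> m) k" "u (j - 1) \<in> DG_space \<Omega> (\<K> m) k"
      using j by (auto intro!: space)
    have v_eq: "?v = (\<lambda>x. (u j x + u (j - 1) x) / 2)"
      by (simp add: fun_eq_iff time_avg_def)
    have v: "?v \<in> DG_space \<Omega> (\<K> m) k"
      unfolding v_eq by (intro DG_space_midpoint in_space)
    have "0 \<le> Re ?A"
      using coercive[OF v] C(1) by (meson order_trans zero_le_mult_iff less_imp_le zero_le_power2)
    obtain r where r: "r \<ge> 0"
      "L2_inner \<Omega> (\<lambda>x. (of_real (cmod (?v x)))\<^sup>2 * ?v x) ?v = of_real r"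
      using L2_inner_cubic by blast
    \<comment> \<open>In the scheme tested with \<open>?v\<close>, \<open>\<alpha>\<close> and
      \<open>\<beta>\<close> multiply real quantities, so they vanish from the real part.\<close>
    have "Re (L2_inner \<Omega> (time_diff \<tau> u j) ?v) + \<nu> * Re ?A + \<kappa> * r - \<gamma> * (L2_norm \<Omega> ?v)\<^sup>2 = 0"
      using arg_cong[OF scheme[OF j v], of Re]
      unfolding r(2) L2_inner_self[of _ ?v] by (simp add: DG_form_self_real)
    moreover have "0 \<le> \<nu> * Re ?A" "0 \<le> \<kappa> * r"
      using \<open>0 \<le> Re ?A\<close> r(1) \<nu> \<kappa> by auto
    ultimately have "?D / (2 * \<tau>) \<le> \<gamma> * (L2_norm \<Omega> ?v)\<^sup>2"
      using Re_L2_inner_time_diff[OF in_space[THEN DG_space_L2], of \<tau>] by linarith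
    \<comment> \<open>A nonnegative coefficient is needed before the midpoint bound can be inserted,
      since \<open>\<gamma>\<close> may be negative.\<close>
    also have "\<dots> \<le> max 0 \<gamma> * (L2_norm \<Omega> ?v)\<^sup>2"
      by (intro mult_right_mono) auto
    also have "\<dots> \<le> max 0 \<gamma> * ((L2_norm \<Omega> (u j))\<^sup>2 / 3 + (L2_norm \<Omega> (u (j - 1)))\<^sup>2)"
      unfolding v_eq by (intro mult_left_mono L2_norm_midpoint_le in_space[THEN DG_space_L2]) auto
    finally have "?D \<le> 2 * s * ((L2_norm \<Omega> (u j))\<^sup>2 / 3 + (L2_norm \<Omega> (u (j - 1)))\<^sup>2)"
      using \<open>\<tau> > 0\<close> by (simp only: s_def pos_divide_le_eq mult_pos_pos zero_less_numeral mult_ac)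
    then show ?thesis
      using s by (intro growth_factor L2_norm_nonneg) auto
  qed
  have "L2_norm \<Omega> (u j) \<le> exp (2 * s) ^ j * L2_norm \<Omega> (u 0)" if "j \<le> N" for j
    using that
  proof (induction j)
    case (Suc j)
    have "L2_norm \<Omega> (u (Suc j)) \<le> exp (2 * s) * L2_norm \<Omega> (u j)"
      using one_step[of "Suc j"] Suc.prems by simp
    also have "\<dots> \<le> exp (2 * s) * (exp (2 * s) ^ j * L2_norm \<Omega> (u 0))"
      using Suc by (intro mult_left_mono) auto
    finally show ?case
      by (simp add: mult.assoc)
  qed simp
  then have "L2_norm \<Omega> (u n) \<le> exp (2 * s) ^ n * L2_norm \<Omega> (u 0)"
    using n by simp
  \<comment> \<open>Replacing \<open>n\<close> by \<open>N\<close> costs nothing as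
    \<open>s \<ge> 0\<close>, and \<open>N * s = T * max 0 \<gamma>\<close> because
    \<open>\<tau> = T / N\<close>.\<close>
  also have "\<dots> \<le> exp (2 * s) ^ N * L2_norm \<Omega> (u 0)"
    using n s(1) by (intro mult_right_mono power_increasing L2_norm_nonneg) auto
  also have "exp (2 * s) ^ N = exp (2 * T * max 0 \<gamma>)"
    using N by (simp add: s_def \<tau> flip: exp_of_nat_mult)
  finally show "L2_norm \<Omega> (u n) \<le> exp (2 * T * max 0 \<gamma>) * L2_norm \<Omega> (u 0)" .
qed

end
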